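(* Assume each bonus function $f_i$ is nonnegative, nondecreasing, and discrete concave on $\{0,1,\dots,b_i\}$ with $f_i(0)=0$. Fix a feasible base allocation $\boldsymbol s$. For any repair increment $\boldsymbol d$ from $\boldsymbol s$ with $D=\|\boldsymbol d\|_1\ge1$, there exists a repair order $\eta=(\eta_1,\dots,\eta_D)$ for $\boldsymbol d$ such that, for every $h=0,1,\dots,D$, the prefix increment $\boldsymbol d^{(h)}$ induced by the first $h$ allocations in $\eta$ satisfies $$V(\boldsymbol s+\boldsymbol d^{(h)})-V(\boldsymbol s)\ \ge\ \left(\frac hD\right)^2\bigl(V(\boldsymbol s+\boldsymbol d)-V(\boldsymbol s)\bigr).$$ Moreover, such an order can be constructed by reverse deletion: initialize $\boldsymbol d^{\mathrm{rem}}=\boldsymbol d$ and an empty deletion list; while $\|\boldsymbol d^{\mathrm{rem}}\|_1>0$, choose a product $i$ with $d^{\mathrm{rem}}_i>0$ that minimizes $V(\boldsymbol s+\boldsymbol d^{\mathrm{rem}})-V(\boldsymbol s+\boldsymbol d^{\mathrm{rem}}-\boldsymbol e_i)$ (where $\boldsymbol e_i$ is the $i$-th unit vector), delete one unit of product $i$ from $\boldsymbol d^{\mathrm{rem}}$, and append $i$ to the deletion list. Reversing the deletion list gives the repair order $\eta$.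
   Context: There are products $\mathcal I=\{1,\dots,m\}$ with capacities $b_i\in\mathbb Z_+$, base rewards $r_i\ge0$ and bonus functions $f_i:\mathbb Z_+\to\mathbb R_+$. Let $R_i(n)=n r_i+\sum_{k=1}^n f_i(k)$ for $n=1,\dots,b_i$, $R_i(0)=0$, and $V(\boldsymbol x)=\sum_{i\in\mathcal I}R_i(x_i)$. Discrete concavity of $f_i$ on $\{0,\dots,b_i\}$: $f_i(k+1)-f_i(k)\le f_i(k)-f_i(k-1)$ for $k=1,\dots,b_i-1$. A feasible base allocation is $\boldsymbol s\in\mathbb Z_+^m$ with $s_i\le b_i$ for all $i$. A (feasible) repair increment from $\boldsymbol s$ is $\boldsymbol d\in\mathbb Z_+^m$ with $0\le d_i\le b_i-s_i$ for every $i$. A repair order for $\boldsymbol d$, with $D=\|\boldsymbol d\|_1=\sum_i d_i$, is a sequence $\eta=(\eta_1,\dots,\eta_D)$ of products containing exactly $d_i$ copies of each product $i$. For $h=0,\dots,D$, the prefix increment $\boldsymbol d^{(h)}$ is given by $d^{(h)}_i=|\{\tau\le h:\eta_\tau=i\}|$. *)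

theory Defs
  imports Complex_Main "HOL-Library.Function_Algebras"
begin

text \<open>
  The products are the elements of a finite type \<open>'p\<close> (so \<open>m = CARD('p)\<close>), and vectors of
  nonnegative integers indexed by products are functions \<open>'p \<Rightarrow> nat\<close> with the pointwise
  operations. Throughout, \<open>b\<close> are the capacities, \<open>r\<close> the base rewards, \<open>f\<close> the bonus functions.
\<close>

definition reward :: "('p \<Rightarrow> real) \<Rightarrow> ('p \<Rightarrow> nat \<Rightarrow> real) \<Rightarrow> 'p \<Rightarrow> nat \<Rightarrow> real" where
  "reward r f i n = real n * r i + (\<Sum>k = 1..n. f i k)"

definition total_value :: "('p::finite \<Rightarrow> real) \<Rightarrow> ('p \<Rightarrow> nat \<Rightarrow> real) \<Rightarrow> ('p \<Rightarrow> nat) \<Rightarrow> real" where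
  "total_value r f x = (\<Sum>i\<in>UNIV. reward r f i (x i))"

definition discrete_concave_upto :: "nat \<Rightarrow> (nat \<Rightarrow> real) \<Rightarrow> bool" where
  "discrete_concave_upto B g \<longleftrightarrow> (\<forall>k\<in>{1..B - 1}. g (k + 1) - g k \<le> g k - g (k - 1))"

definition feasible_base :: "('p \<Rightarrow> nat) \<Rightarrow> ('p \<Rightarrow> nat) \<Rightarrow> bool" where
  "feasible_base b s \<longleftrightarrow> (\<forall>i. s i \<le> b i)"

text \<open>The subtraction below is not truncated when \<open>s\<close> is a feasible base allocation.\<close>

definition repair_increment :: "('p \<Rightarrow> nat) \<Rightarrow> ('p \<Rightarrow> nat) \<Rightarrow> ('p \<Rightarrow> nat) \<Rightarrow> bool" where
  "repair_increment b s d \<longleftrightarrow> (\<forall>i. d i \<le> b i - s i)"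

definition l1 :: "('p::finite \<Rightarrow> nat) \<Rightarrow> nat" where
  "l1 d = (\<Sum>i\<in>UNIV. d i)"

definition unit_vec :: "'p \<Rightarrow> 'p \<Rightarrow> nat" where
  "unit_vec i = (\<lambda>j. if j = i then 1 else 0)"

definition repair_order :: "('p::finite \<Rightarrow> nat) \<Rightarrow> 'p list \<Rightarrow> bool" where
  "repair_order d \<eta> \<longleftrightarrow> length \<eta> = l1 d \<and> (\<forall>i. count_list \<eta> i = d i)"

text \<open>List positions are counted from 0, so the first \<open>h\<close> entries are those at \<open>\<tau> < h\<close>.\<close>

definition prefix_increment :: "'p list \<Rightarrow> nat \<Rightarrow> 'p \<Rightarrow> nat" where
  "prefix_increment \<eta> h = (\<lambda>i. card {\<tau>. \<tau> < h \<and> \<eta> ! \<tau> = i})"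

definition quadratic_prefix_bound ::
  "('p::finite \<Rightarrow> real) \<Rightarrow> ('p \<Rightarrow> nat \<Rightarrow> real) \<Rightarrow> ('p \<Rightarrow> nat) \<Rightarrow> ('p \<Rightarrow> nat) \<Rightarrow> 'p list \<Rightarrow> bool" where
  "quadratic_prefix_bound r f s d \<eta> \<longleftrightarrow>
     (\<forall>h\<in>{0..l1 d}.
        total_value r f (s + prefix_increment \<eta> h) - total_value r f s
          \<ge> (real h / real (l1 d))\<^sup>2 * (total_value r f (s + d) - total_value r f s))"

text \<open>
  One iteration of reverse deletion on states (remaining increment, deletion list). It is a
  relation rather than a function because ties between minimizers may be broken arbitrarily.
\<close>

inductive deletion_step ::
  "('p::finite \<Rightarrow> real) \<Rightarrow> ('p \<Rightarrow> nat \<Rightarrow> real) \<Rightarrow> ('p \<Rightarrow> nat)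
     \<Rightarrow> ('p \<Rightarrow> nat) \<times> 'p list \<Rightarrow> ('p \<Rightarrow> nat) \<times> 'p list \<Rightarrow> bool"
  for r f s where
  "l1 drem > 0 \<Longrightarrow>
   is_arg_min (\<lambda>i. total_value r f (s + drem) - total_value r f (s + drem - unit_vec i))
     (\<lambda>i. drem i > 0) i \<Longrightarrow>
   deletion_step r f s (drem, L) (drem - unit_vec i, L @ [i])"

text \<open>\<open>L\<close> is the deletion list (not yet reversed) of some completed run started from \<open>d\<close>.\<close>

definition reverse_deletion_list ::
  "('p::finite \<Rightarrow> real) \<Rightarrow> ('p \<Rightarrow> nat \<Rightarrow> real) \<Rightarrow> ('p \<Rightarrow> nat) \<Rightarrow> ('p \<Rightarrow> nat) \<Rightarrow> 'p list \<Rightarrow> bool" where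
  "reverse_deletion_list r f s d L \<longleftrightarrow>
     (\<exists>drem. l1 drem = 0 \<and> (deletion_step r f s)\<^sup>*\<^sup>* (d, []) (drem, L))"

end

theory Submission
  imports Defs
begin

text \<open>
  The marginal values of a product beyond the base allocation form a nonnegative concave
  sequence \<open>w\<close>, so \<open>w 1 + \<dots> + w n\<close> is at least \<open>(n + 1) w n / 2\<close>. Summed over the products, this
  bounds the smallest last marginal of an increment of size \<open>D\<close> by \<open>2 / (D + 1)\<close>, and hence by
  \<open>1 - ((D - 1) / D)\<^sup>2\<close>, times the total gain. Deleting that unit keeps at least the fraction
  \<open>((D - 1) / D)\<^sup>2\<close> of the gain, and these fractions telescope to \<open>(h / D)\<^sup>2\<close>.
\<close>

text \<open>In effect \<open>g k / k\<close> is nonincreasing for positive \<open>k\<close>, since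
  the graph starts at or above the origin. Concavity at \<open>k + 1\<close>, scaled by
  \<open>k + 1\<close>, leaves a term \<open>- (k + 1) * g k\<close>, which the induction hypothesis
  bounds by \<open>- k * g (k + 1)\<close>.\<close>

lemma discrete_concave_ratio:
  fixes g :: "nat \<Rightarrow> real"
  assumes "g 0 \<ge> 0"
    and "\<And>k. k \<ge> 1 \<Longrightarrow> k < n \<Longrightarrow> g (k + 1) - g k \<le> g k - g (k - 1)"
    and "k < n"
  shows "real k * g (k + 1) \<le> real (k + 1) * g k"
  using assms(3)
proof (induction k)
  case 0
  then show ?case using assms(1) by simp
next
  case (Suc k)
  have "g (k + 2) \<le> 2 * g (k + 1) - g k"
    using assms(2)[of "Suc k"] Suc.prems by simp
  then have "real (k + 1) * g (k + 2) \<le> real (k + 1) * (2 * g (k + 1) - g k)"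
    by (intro mult_left_mono) auto
  with Suc show ?case by (simp add: algebra_simps)
qed

text \<open>Passing from \<open>m\<close> to \<open>m + 1\<close> adds \<open>2 * g (m + 1)\<close>
  to the right side, so what remains is \<open>m * g (m + 1)\<close> against twice the old sum. The
  ratio bound puts \<open>(m + 1) * g m\<close> between them.\<close>

lemma discrete_concave_sum_ge:
  fixes g :: "nat \<Rightarrow> real"
  assumes "g 0 \<ge> 0"
    and "\<And>k. k \<ge> 1 \<Longrightarrow> k < n \<Longrightarrow> g (k + 1) - g k \<le> g k - g (k - 1)"
    and "m \<ge> 1" "m \<le> n"
  shows "real (m + 1) * g m \<le> 2 * (\<Sum>k = 1..m. g k)"
  using assms(3,4)
proof (induction m rule: dec_induct)
  case base
  then show ?case by simp
next
  case (step m)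
  have "real m * g (m + 1) \<le> real (m + 1) * g m"
    using discrete_concave_ratio[of g n m] assms(1,2) step.prems by auto
  with step show ?case by (simp add: algebra_simps)
qed

lemma reward_add:
  "reward r f i (x + n) = reward r f i x + (\<Sum>k = 1..n. r i + f i (x + k))"
  by (induction n) (simp_all add: reward_def algebra_simps)

lemma total_value_add:
  "total_value r f (s + e) - total_value r f s =
     (\<Sum>i\<in>UNIV. \<Sum>k = 1..e i. r i + f i (s i + k))"
  by (simp add: total_value_def reward_add sum.distrib)

lemma add_unit_vec_cancel: "e i > 0 \<Longrightarrow> (e - unit_vec i) + unit_vec i = e"
  by (auto simp: fun_eq_iff unit_vec_def)

lemma total_value_add_unit_vec:
  "total_value r f (x + unit_vec i) - total_value r f x = r i + f i (x i + 1)"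
proof -
  have "(\<Sum>k = 1..unit_vec i j. r j + f j (x j + k)) = (if j = i then r i + f i (x i + 1) else 0)"
    for j by (simp add: unit_vec_def)
  then show ?thesis by (simp add: total_value_add)
qed

lemma last_marginal:
  assumes "e i > 0"
  shows "total_value r f (s + e) - total_value r f (s + e - unit_vec i) = r i + f i (s i + e i)"
proof -
  have "s + e - unit_vec i + unit_vec i = s + e"
    using assms by (intro add_unit_vec_cancel) simp
  moreover have "(s + e - unit_vec i) i + 1 = s i + e i"
    using assms by (simp add: unit_vec_def)
  ultimately show ?thesis
    using total_value_add_unit_vec[of r f "s + e - unit_vec i" i] by simp
qed

lemma l1_add: "l1 (x + y) = l1 x + l1 y"
  by (simp add: l1_def sum.distrib)

lemma l1_unit_vec [simp]: "l1 (unit_vec i) = 1"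
  by (simp add: l1_def unit_vec_def)

lemma l1_diff_unit_vec: "e i > 0 \<Longrightarrow> Suc (l1 (e - unit_vec i)) = l1 e"
  using l1_add[of "e - unit_vec i" "unit_vec i"] add_unit_vec_cancel[of e i] by simp

lemma l1_eq_0_iff: "l1 e = 0 \<longleftrightarrow> (\<forall>i. e i = 0)"
  by (simp add: l1_def)

text \<open>The bound on \<open>h\<close> keeps every index inside the list. In the
  \<open>take\<close> form, appending an entry visibly leaves the shorter prefixes
  unchanged.\<close>

lemma prefix_increment_eq_count_list:
  "h \<le> length xs \<Longrightarrow> prefix_increment xs h = count_list (take h xs)"
proof (induction h)
  case 0
  then show ?case by (simp add: prefix_increment_def fun_eq_iff)
next
  case (Suc h)
  have "{\<tau>. \<tau> < Suc h \<and> xs ! \<tau> = i} =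
      {\<tau>. \<tau> < h \<and> xs ! \<tau> = i} \<union> (if xs ! h = i then {h} else {})" for i
    by (auto simp: less_Suc_eq)
  then have "prefix_increment xs (Suc h) i = prefix_increment xs h i + (if xs ! h = i then 1 else 0)"
    for i by (simp add: prefix_increment_def)
  with Suc show ?case by (auto simp: take_Suc_conv_app_nth fun_eq_iff)
qed

lemma repair_order_snoc:
  assumes "e i > 0" "repair_order (e - unit_vec i) \<eta>"
  shows "repair_order e (\<eta> @ [i])"
proof -
  have "count_list \<eta> j + unit_vec i j = e j" for j
    using assms by (simp add: repair_order_def unit_vec_def)
  then show ?thesis
    using assms l1_diff_unit_vec[of e i] by (auto simp: repair_order_def unit_vec_def)
qed

lemma min_marginal_le:
  assumes r: "\<And>i. r i \<ge> 0" and f: "\<And>i k. f i k \<ge> 0"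
    and conc: "\<And>i. discrete_concave_upto (b i) (f i)"
    and s: "feasible_base b s" and e: "repair_increment b s e"
    and min: "is_arg_min (\<lambda>i. total_value r f (s + e) - total_value r f (s + e - unit_vec i))
      (\<lambda>i. e i > 0) i"
  shows "(real (l1 e) + 1) * (r i + f i (s i + e i))
    \<le> 2 * (total_value r f (s + e) - total_value r f s)"
proof -
  define w where "w j k = r j + f j (s j + k)" for j k
  define \<mu> where "\<mu> = w i (e i)"
  have ei: "e i > 0" using min by (simp add: is_arg_min_def)
  have \<mu>0: "\<mu> \<ge> 0" by (simp add: \<mu>_def w_def r f)
  have \<mu>_le: "\<mu> \<le> w j (e j)" if "e j > 0" for j
    using min that ei by (auto simp: is_arg_min_linorder last_marginal \<mu>_def w_def)
  have term_ge: "real (e j + 1) * \<mu> \<le> 2 * (\<Sum>k = 1..e j. w j k)" if ej: "e j > 0" for j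
  proof -
    \<comment> \<open>Feasibility of \<open>s\<close> makes \<open>b j - s j\<close> a genuine
      difference, so concavity is available at each \<open>s j + k\<close> with
      \<open>0 < k < e j\<close>.\<close>
    have cap: "s j + e j \<le> b j"
      using s e le_diff_conv2[of "s j" "b j" "e j"]
      by (simp add: feasible_base_def repair_increment_def add.commute)
    have "w j (k + 1) - w j k \<le> w j k - w j (k - 1)" if "k \<ge> 1" "k < e j" for k
    proof -
      have "s j + k \<in> {1..b j - 1}" using that cap by auto
      then have "f j (s j + k + 1) - f j (s j + k) \<le> f j (s j + k) - f j (s j + k - 1)"
        using conc[of j] unfolding discrete_concave_upto_def by blast
      then show ?thesis using that by (simp add: w_def add.assoc)
    qed
    \<comment> \<open>The value at \<open>0\<close> is not a marginal of the increment; it is the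
      nonnegative start of the concave sequence.\<close>
    moreover have "w j 0 \<ge> 0" by (simp add: w_def r f)
    ultimately have "real (e j + 1) * w j (e j) \<le> 2 * (\<Sum>k = 1..e j. w j k)"
      using discrete_concave_sum_ge[of "w j" "e j" "e j"] ej by auto
    moreover have "real (e j + 1) * \<mu> \<le> real (e j + 1) * w j (e j)"
      using \<mu>_le[OF ej] by (intro mult_left_mono) auto
    ultimately show ?thesis by linarith
  qed
  \<comment> \<open>Of the weights \<open>e j + 1\<close>, only that of \<open>i\<close> keeps its
    extra \<open>1\<close>: one is guaranteed, because \<open>e i > 0\<close>, while products
    without units supply none. The rest is dropped using \<mu> \<ge> 0.\<close>
  have "(real (l1 e) + 1) * \<mu> = (\<Sum>j\<in>UNIV. (real (e j) + (if j = i then 1 else 0)) * \<mu>)"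
    by (simp add: l1_def sum.distrib sum_distrib_right[symmetric])
  also have "\<dots> \<le> (\<Sum>j\<in>UNIV. 2 * (\<Sum>k = 1..e j. w j k))"
  proof (rule sum_mono)
    fix j
    show "(real (e j) + (if j = i then 1 else 0)) * \<mu> \<le> 2 * (\<Sum>k = 1..e j. w j k)"
    proof (cases "e j > 0")
      case True
      have "(real (e j) + (if j = i then 1 else 0)) * \<mu> \<le> real (e j + 1) * \<mu>"
        using \<mu>0 by (intro mult_right_mono) auto
      with term_ge[OF True] show ?thesis by linarith
    next
      case False
      with ei show ?thesis by auto
    qed
  qed
  also have "\<dots> = 2 * (total_value r f (s + e) - total_value r f s)"
    by (simp add: total_value_add w_def sum_distrib_left)
  finally show ?thesis by (simp add: \<mu>_def w_def)
qed

lemma gain_after_deletion: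
  fixes e :: "'p::finite \<Rightarrow> nat"
  assumes r: "\<And>i. r i \<ge> 0" and f: "\<And>i k. f i k \<ge> 0"
    and conc: "\<And>i. discrete_concave_upto (b i) (f i)"
    and s: "feasible_base b s" and e: "repair_increment b s e"
    and min: "is_arg_min (\<lambda>i. total_value r f (s + e) - total_value r f (s + e - unit_vec i))
      (\<lambda>i. e i > 0) i"
  shows "((real (l1 e) - 1) / real (l1 e))\<^sup>2 * (total_value r f (s + e) - total_value r f s)
    \<le> total_value r f (s + (e - unit_vec i)) - total_value r f s"
proof -
  define D where "D = real (l1 e)"
  define G where "G = total_value r f (s + e) - total_value r f s"
  define \<mu> where "\<mu> = r i + f i (s i + e i)"
  have ei: "e i > 0" using min by (simp add: is_arg_min_def)
  have D: "D \<ge> 1" using l1_diff_unit_vec[of e i] ei by (simp add: D_def)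
  have le: "(D + 1) * \<mu> \<le> 2 * G"
    using min_marginal_le[OF assms] by (simp add: D_def G_def \<mu>_def)
  have G0: "G \<ge> 0" unfolding G_def total_value_add by (intro sum_nonneg add_nonneg_nonneg r f)
  \<comment> \<open>Denominators are cleared in
    \<open>2 / (D + 1) \<le> (2 * D - 1) / D\<^sup>2\<close>, whose right side is the fraction of
    the gain that may be lost.\<close>
  have "(D + 1) * (D\<^sup>2 * \<mu>) \<le> D\<^sup>2 * (2 * G)"
    using mult_left_mono[OF le, of "D\<^sup>2"] by (simp add: mult.left_commute)
  also have "\<dots> \<le> (D + 1) * ((2 * D - 1) * G)"
  proof -
    \<comment> \<open>This is exactly the slack:
      \<open>(D + 1) * (2 * D - 1) - 2 * D\<^sup>2 = D - 1\<close>.\<close>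
    have "0 \<le> (D - 1) * G" using D G0 by simp
    then show ?thesis by (simp add: algebra_simps power2_eq_square)
  qed
  finally have "D\<^sup>2 * \<mu> \<le> (2 * D - 1) * G"
    using D by simp
  then have "(D - 1)\<^sup>2 * G \<le> D\<^sup>2 * (G - \<mu>)"
    by (simp add: algebra_simps power2_eq_square)
  then have "((D - 1) / D)\<^sup>2 * G \<le> G - \<mu>"
    using D by (simp add: power_divide divide_le_eq mult.commute)
  \<comment> \<open>Subtraction is truncated, so this regrouping relies on
    \<open>e i > 0\<close>.\<close>
  moreover have "s + e - unit_vec i = s + (e - unit_vec i)"
    using ei by (auto simp: fun_eq_iff unit_vec_def)
  then have "total_value r f (s + (e - unit_vec i)) - total_value r f s = G - \<mu>"
    using last_marginal[where e = e and i = i and r = r and f = f and s = s] ei by (simp add: G_def \<mu>_def)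
  ultimately show ?thesis by (simp add: D_def G_def)
qed

text \<open>The unit deleted first comes last in the order. The full prefix attains the whole gain;
  a shorter one is a prefix of \<open>\<eta>\<close>, and its fraction factors through size
  \<open>l1 e - 1\<close>.\<close>

lemma quadratic_prefix_bound_snoc:
  fixes e :: "'p::finite \<Rightarrow> nat"
  assumes ei: "e i > 0" and order: "repair_order (e - unit_vec i) \<eta>"
    and bound: "quadratic_prefix_bound r f s (e - unit_vec i) \<eta>"
    and step: "((real (l1 e) - 1) / real (l1 e))\<^sup>2 * (total_value r f (s + e) - total_value r f s)
      \<le> total_value r f (s + (e - unit_vec i)) - total_value r f s"
  shows "quadratic_prefix_bound r f s e (\<eta> @ [i])"
  unfolding quadratic_prefix_bound_def
proof
  fix h assume h: "h \<in> {0..l1 e}"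
  let ?G = "\<lambda>x. total_value r f (s + x) - total_value r f s"
  define n where "n = l1 (e - unit_vec i)"
  have l1e: "l1 e = Suc n" using l1_diff_unit_vec[of e i] ei by (simp add: n_def)
  have len: "length \<eta> = n" using order by (simp add: repair_order_def n_def)
  show "(real h / real (l1 e))\<^sup>2 * ?G e \<le> ?G (prefix_increment (\<eta> @ [i]) h)"
  proof (cases "h = Suc n")
    case True
    have "prefix_increment (\<eta> @ [i]) h = e"
      using repair_order_snoc[OF ei order] True len l1e
      by (simp add: prefix_increment_eq_count_list repair_order_def fun_eq_iff)
    then show ?thesis using True l1e by simp
  next
    case False
    then have hn: "h \<le> n" using h l1e by simp
    have "(real h / real (l1 e))\<^sup>2 * ?G e
        = (real h / real n)\<^sup>2 * (((real (l1 e) - 1) / real (l1 e))\<^sup>2 * ?G e)"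
      \<comment> \<open>If \<open>n = 0\<close> then \<open>h = 0\<close>, and both sides vanish
        since \<open>0 / 0 = 0\<close>.\<close>
      using l1e hn by (cases "n = 0") (simp_all add: power_divide)
    also have "\<dots> \<le> (real h / real n)\<^sup>2 * ?G (e - unit_vec i)"
      using step by (intro mult_left_mono) auto
    also have "\<dots> \<le> ?G (prefix_increment \<eta> h)"
      using bound hn by (auto simp: quadratic_prefix_bound_def n_def)
    also have "prefix_increment \<eta> h = prefix_increment (\<eta> @ [i]) h"
      using hn len by (simp add: prefix_increment_eq_count_list)
    finally show ?thesis .
  qed
qed

text \<open>Each step lowers \<open>l1\<close> by one, and a minimizer exists because there are
  finitely many products.\<close>

lemma reverse_deletion_run_exists:
  "\<exists>z L'. l1 z = 0 \<and> (deletion_step r f s)\<^sup>*\<^sup>* (e, L) (z, L')"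
proof (induction "l1 e" arbitrary: e L)
  case 0
  then show ?case by (metis rtranclp.rtrancl_refl)
next
  case (Suc n)
  let ?m = "\<lambda>i. total_value r f (s + e) - total_value r f (s + e - unit_vec i)"
  have "\<exists>i. e i > 0" using Suc.hyps(2) l1_eq_0_iff[of e] by auto
  then obtain i where i: "is_arg_min ?m (\<lambda>i. e i > 0) i"
    using ex_is_arg_min_if_finite[of "{i. e i > 0}" ?m] by (auto simp: is_arg_min_def)
  then have "n = l1 (e - unit_vec i)"
    using Suc.hyps(2) l1_diff_unit_vec[of e i] by (simp add: is_arg_min_def)
  from Suc.hyps(1)[OF this, of "L @ [i]"] obtain z L' where
    "l1 z = 0" "(deletion_step r f s)\<^sup>*\<^sup>* (e - unit_vec i, L @ [i]) (z, L')" by blast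
  moreover have "deletion_step r f s (e, L) (e - unit_vec i, L @ [i])"
    using Suc.hyps(2) i by (intro deletion_step.intros) auto
  ultimately show ?case by (meson converse_rtranclp_into_rtranclp)
qed

text \<open>Induction peels off the first step of the run, so the list \<open>L\<close> accumulated
  so far must be arbitrary; \<open>M\<close> isolates the deletions still to come.\<close>

lemma reverse_deletion_run_bound:
  fixes e :: "'p::finite \<Rightarrow> nat"
  assumes r: "\<And>i. r i \<ge> 0" and f: "\<And>i k. f i k \<ge> 0"
    and conc: "\<And>i. discrete_concave_upto (b i) (f i)"
    and s: "feasible_base b s" and e: "repair_increment b s e"
    and run: "(deletion_step r f s)\<^sup>*\<^sup>* (e, L) (z, L')" and z: "l1 z = 0"
  shows "\<exists>M. L' = L @ M \<and> repair_order e (rev M) \<and> quadratic_prefix_bound r f s e (rev M)"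
  using run e
proof (induction e L rule: converse_rtranclp_induct2)
  case refl
  have "repair_order z []" using z l1_eq_0_iff[of z] by (simp add: repair_order_def)
  \<comment> \<open>Only \<open>h = 0\<close> occurs, and its ratio \<open>0 / 0\<close> is
    \<open>0\<close>.\<close>
  moreover have "quadratic_prefix_bound r f s z []"
  proof -
    have "prefix_increment ([] :: 'p list) 0 = (\<lambda>i. 0)" by (simp add: prefix_increment_def)
    then show ?thesis by (simp add: quadratic_prefix_bound_def z total_value_def)
  qed
  ultimately show ?case by simp
next
  case (step e L e' K)
  then obtain i where eq: "e' = e - unit_vec i" "K = L @ [i]"
    and min: "is_arg_min (\<lambda>i. total_value r f (s + e) - total_value r f (s + e - unit_vec i))
      (\<lambda>i. e i > 0) i"
    by (auto elim: deletion_step.cases)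
  have ei: "e i > 0" using min by (simp add: is_arg_min_def)
  have "repair_increment b s e'"
    using step.prems by (auto simp: repair_increment_def eq intro: le_trans[OF diff_le_self])
  from step.IH[OF this] obtain M where M: "L' = K @ M" "repair_order e' (rev M)"
    "quadratic_prefix_bound r f s e' (rev M)" by blast
  have "repair_order e (rev (i # M))"
    using repair_order_snoc[of e i "rev M"] ei M(2) by (simp add: eq)
  moreover have "quadratic_prefix_bound r f s e (rev (i # M))"
    using quadratic_prefix_bound_snoc[of e i "rev M" r f s] ei M(2,3)
      gain_after_deletion[OF r f conc s step.prems min] by (simp add: eq)
  moreover have "L' = L @ (i # M)" using M(1) eq by simp
  ultimately show ?case by blast
qed

theorem lemma1:
  fixes b s d :: "'p::finite \<Rightarrow> nat"
    and r :: "'p \<Rightarrow> real"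
    and f :: "'p \<Rightarrow> nat \<Rightarrow> real"
  assumes "\<And>i. r i \<ge> 0"
    and "\<And>i k. f i k \<ge> 0"
    and "\<And>i. mono_on {0..b i} (f i)"
    and "\<And>i. discrete_concave_upto (b i) (f i)"
    and "\<And>i. f i 0 = 0"
    and "feasible_base b s"
    and "repair_increment b s d"
    and "l1 d \<ge> 1"
  shows "(\<exists>\<eta>. repair_order d \<eta> \<and> quadratic_prefix_bound r f s d \<eta>)
    \<and> (\<exists>L. reverse_deletion_list r f s d L)
    \<and> (\<forall>L. reverse_deletion_list r f s d L \<longrightarrow>
         repair_order d (rev L) \<and> quadratic_prefix_bound r f s d (rev L))"
proof -
  have run_exists: "\<exists>L. reverse_deletion_list r f s d L"
    using reverse_deletion_run_exists[of r f s d "[]"] by (auto simp: reverse_deletion_list_def)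
  have bound: "repair_order d (rev L) \<and> quadratic_prefix_bound r f s d (rev L)"
    if "reverse_deletion_list r f s d L" for L
    using that reverse_deletion_run_bound[OF assms(1,2,4,6,7), where L = "[]" and L' = L]
    by (auto simp: reverse_deletion_list_def)
  \<comment> \<open>The first conjunct follows from the other two: the reversal of any completed run
    is a witness.\<close>
  from run_exists bound show ?thesis by blast
qed

end
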